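(* Let $m,\ell$ be coprime integers with $\ell>m$, let $c_1,c_2$ be nonzero real numbers, and let $f(t)=c_1e^{itm}+c_2e^{it\ell}$, $t\in\mathbb{R}$. Suppose that $$w_0=f(t_0)=f(s_0)\neq0\qquad (t_0\not\equiv s_0 \bmod 2\pi)$$ is a self-intersection point of the curve $f$. Put $t_k:=t_0+\frac{2k\pi}{\ell-m}$ and $s_j:=s_0+\frac{2j\pi}{\ell-m}$ for $0\le k,j\le \ell-m-1$. Then: 1. $t_k\not\equiv t_j$ and $s_k\not\equiv s_j \pmod{2\pi}$ for $k\neq j$, and $t_k\not\equiv s_j\pmod{2\pi}$ for all $0\le k,j\le\ell-m-1$. 2. $f(t_k)=f(s_k)$ for $0\le k\le \ell-m-1$. 3. The points $w_k=f(t_k)=f(s_k)$ $(0\le k\le\ell-m-1)$ are different self-intersection points of the curve $f$. 4. If a point $w=f(\tau)$ of the curve satisfies $|w|=|f(t_0)|$, then $$(\ast)\qquad \tau\equiv t_k \pmod{2\pi}\ \text{ or }\ \tau\equiv s_j\pmod{2\pi}\quad\text{for some } 0\le k,j\le\ell-m-1.$$ 5. If $\tau$ satisfies $(\ast)$, then $-\tau$ satisfies $(\ast)$ as well. 6. For the self-intersection point $w_k$ there is only one point modulo $2\pi$ that differs from $t_k$ modulo $2\pi$ and at which $f$ takes the value $f(t_k)$, namely the point $s_k$ modulo $2\pi$.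
   Context: Write $f=x+iy$ with $x,y$ real-valued. The point $w_0=f(t_0)=f(s_0)$ ($t_0\not\equiv s_0$ mod $2\pi$) is a self-intersection point of the curve $f$ if the curve has different tangent lines there, i.e. $\dot y(t_0)/\dot x(t_0)\neq\dot y(s_0)/\dot x(s_0)$ (slope $\infty$ allowed when $\dot x=0\neq \dot y$). *)

theory Defs
  imports "HOL-Analysis.Analysis" "HOL-Library.Real_Mod"
begin

definition x_dot :: "(real \<Rightarrow> complex) \<Rightarrow> real \<Rightarrow> real" where
  "x_dot f t = deriv (\<lambda>u. Re (f u)) t"

definition y_dot :: "(real \<Rightarrow> complex) \<Rightarrow> real \<Rightarrow> real" where
  "y_dot f t = deriv (\<lambda>u. Im (f u)) t"

definition has_slope :: "(real \<Rightarrow> complex) \<Rightarrow> real \<Rightarrow> bool" where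
  "has_slope f t \<longleftrightarrow> x_dot f t \<noteq> 0 \<or> y_dot f t \<noteq> 0"

text \<open>
  The slope lives in the reals extended by a single unsigned infinity, which encodes the vertical
  direction; \<open>-\<infinity>\<close> is never used. The value is meaningful only under \<^const>\<open>has_slope\<close>.
\<close>
definition slope :: "(real \<Rightarrow> complex) \<Rightarrow> real \<Rightarrow> ereal" where
  "slope f t = (if x_dot f t = 0 then \<infinity> else ereal (y_dot f t / x_dot f t))"

text \<open>
  \<open>w\<close> is a self-intersection point of the (differentiable, \<open>2\<pi>\<close>-periodic) curve \<open>f\<close>, attained
  at the parameters \<open>t\<close> and \<open>s\<close>, which are distinct modulo \<open>2\<pi>\<close>. At a parameter where both
  derivatives vanish there is no slope, so such parameters are excluded.
\<close>
definition self_intersection_point ::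
  "(real \<Rightarrow> complex) \<Rightarrow> complex \<Rightarrow> real \<Rightarrow> real \<Rightarrow> bool" where
  "self_intersection_point f w t s \<longleftrightarrow>
     w = f t \<and> w = f s \<and> \<not> [t = s] (rmod 2 * pi) \<and>
     has_slope f t \<and> has_slope f s \<and> slope f t \<noteq> slope f s"

end

theory Submission
  imports Defs
begin

text \<open>
  Put \<open>n = l - m\<close>. Two elementary facts about \<open>f\<close> carry everything.

  First, \<open>l\<close> and \<open>m\<close> agree modulo \<open>n\<close>, so advancing the parameter by \<open>2 k \<pi> / n\<close> multiplies both
  exponentials by the same number \<open>exp (2 \<pi> \<i> m k / n)\<close>: the curve is invariant under a rotation
  (\<open>two_mode_shift\<close>). Since \<open>m\<close> and \<open>n\<close> are coprime, this rotation is trivial only for \<open>n dvd k\<close>, so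
  the images of a nonzero point under the \<open>n\<close> shifts are distinct
  (\<open>two_mode_shift_eq_iff\<close>). A rotation keeps distinct tangent directions distinct,
  so a self-intersection is carried to a self-intersection (\<open>self_intersection_point_rotate\<close>).

  Second, \<open>\<bar>f u\<bar>\<^sup>2 = c\<^sub>1\<^sup>2 + c\<^sub>2\<^sup>2 + 2 c\<^sub>1 c\<^sub>2 cos (n u)\<close>, so two parameters give values of the same modulus
  exactly if the corresponding angles \<open>n u\<close> agree up to sign modulo \<open>2 \<pi>\<close> (\<open>norm_two_mode_eq_iff\<close>).
  Now consider \<open>f t\<^sub>0 = f s\<^sub>0 \<noteq> 0\<close>. If \<open>n s\<^sub>0\<close> were congruent to \<open>n t\<^sub>0\<close>, then \<open>s\<^sub>0\<close> would be a shift of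
  \<open>t\<^sub>0\<close> with the same nonzero value, hence the same parameter modulo \<open>2 \<pi>\<close>. Therefore \<open>n s\<^sub>0\<close> is
  congruent to \<open>- n t\<^sub>0\<close> and not to \<open>n t\<^sub>0\<close> (\<open>two_mode_double_point\<close>).

  By \<open>shift_orbit_iff\<close>, the parameters \<open>t\<^sub>k\<close> are those with \<open>n \<tau> \<equiv> n t\<^sub>0\<close> and the \<open>s\<^sub>j\<close> those with
  \<open>n \<tau> \<equiv> n s\<^sub>0 \<equiv> - n t\<^sub>0\<close>. So the two families are disjoint, they are exchanged by
  \<open>\<tau> \<mapsto> - \<tau>\<close>, and together they exhaust the parameters of modulus \<open>\<bar>f t\<^sub>0\<bar>\<close>. Each family takes every
  value at most once, which leaves \<open>t\<^sub>k\<close> and \<open>s\<^sub>k\<close> as the only parameters of the value \<open>f t\<^sub>k\<close>.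
\<close>

section \<open>Rotating a self-intersection\<close>

lemma x_dot_y_dot_eq:
  assumes "(f has_vector_derivative v) (at t)"
  shows "x_dot f t = Re v" and "y_dot f t = Im v"
proof -
  have "((\<lambda>u. Re (f u)) has_vector_derivative Re v) (at t)"
       "((\<lambda>u. Im (f u)) has_vector_derivative Im v) (at t)"
    using bounded_linear.has_vector_derivative[OF bounded_linear_Re assms]
          bounded_linear.has_vector_derivative[OF bounded_linear_Im assms] by simp_all
  then show "x_dot f t = Re v" and "y_dot f t = Im v"
    unfolding x_dot_def y_dot_def
    by (auto intro!: DERIV_imp_deriv simp: has_real_derivative_iff_has_vector_derivative)
qed

text \<open>
  The cross product \<open>Im (cnj v * w)\<close> detects linear dependence over the reals. Unlike the slopes, it
  is visibly compatible with multiplication by complex numbers, and it needs no case distinction for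
  vertical tangents; it also vanishes at singular parameters, so it subsumes \<open>has_slope\<close>.
\<close>
lemma distinct_slopes_iff:
  assumes "(f has_vector_derivative v) (at t)" and "(f has_vector_derivative w) (at s)"
  shows "has_slope f t \<and> has_slope f s \<and> slope f t \<noteq> slope f s \<longleftrightarrow> Im (cnj v * w) \<noteq> 0"
proof -
  have quotients: "Im v / Re v = Im w / Re w \<longleftrightarrow> Re v * Im w = Im v * Re w"
    if "Re v \<noteq> 0" "Re w \<noteq> 0"
    using frac_eq_eq[OF that] by (metis mult.commute)
  show ?thesis
    unfolding has_slope_def slope_def x_dot_y_dot_eq[OF assms(1)] x_dot_y_dot_eq[OF assms(2)]
    by (cases "Re v = 0"; cases "Re w = 0") (simp_all add: quotients)
qed

text \<open>
  By the chain rule, the symmetry multiplies both tangent vectors by \<open>\<omega>\<close>, and their cross product by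
  \<open>\<bar>\<omega>\<bar>\<^sup>2\<close>.
\<close>
lemma self_intersection_point_rotate:
  assumes symmetry: "\<And>u. f (u + d) = \<omega> * f u" and "\<omega> \<noteq> 0"
    and v: "(f has_vector_derivative v) (at t)" and w: "(f has_vector_derivative w) (at s)"
    and self: "self_intersection_point f p t s"
  shows "self_intersection_point f (\<omega> * p) (t + d) (s + d)"
proof -
  have rotated: "(f has_vector_derivative \<omega> * x) (at (a + d))"
    if "(f has_vector_derivative x) (at a)" for a x
  proof -
    have "(\<lambda>u. \<omega> * f (u - d)) = f"
      by (rule ext) (simp flip: symmetry)
    moreover have "((\<lambda>u. \<omega> * f (u - d)) has_vector_derivative \<omega> * x) (at (a + d))"
    proof (rule has_vector_derivative_mult_right)
      have "((\<lambda>u. u - d) has_vector_derivative 1) (at (a + d))"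
        by (auto intro!: derivative_eq_intros)
      then show "((\<lambda>u. f (u - d)) has_vector_derivative x) (at (a + d))"
        using vector_diff_chain_at[of "\<lambda>u. u - d" 1 "a + d" f x] that by (simp add: o_def)
    qed
    ultimately show ?thesis
      by simp
  qed
  have "Im (cnj (\<omega> * v) * (\<omega> * w)) = (norm \<omega>)\<^sup>2 * Im (cnj v * w)"
    unfolding cmod_power2 by (simp add: algebra_simps power2_eq_square)
  moreover have "Im (cnj v * w) \<noteq> 0"
    using self distinct_slopes_iff[OF v w] by (simp add: self_intersection_point_def)
  ultimately have "Im (cnj (\<omega> * v) * (\<omega> * w)) \<noteq> 0"
    using \<open>\<omega> \<noteq> 0\<close> by simp
  then show ?thesis
    using self distinct_slopes_iff[OF rotated[OF v] rotated[OF w]]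
    unfolding self_intersection_point_def symmetry by auto
qed

section \<open>Shifts of the parameter by fractions of the period\<close>

lemma rcong_period_iff: "[a = b] (rmod 2 * pi) \<longleftrightarrow> (\<exists>z. b = a + 2 * of_int z * pi)"
  by (simp add: rcong_altdef mult_ac)

lemma shift_orbit_iff:
  fixes n :: int
  assumes "n > 0"
  shows "(\<exists>k\<in>{0..n-1}. [\<tau> = a + 2 * of_int k * pi / of_int n] (rmod 2 * pi))
           \<longleftrightarrow> [of_int n * \<tau> = of_int n * a] (rmod 2 * pi)"
proof
  assume "\<exists>k\<in>{0..n-1}. [\<tau> = a + 2 * of_int k * pi / of_int n] (rmod 2 * pi)"
  then obtain k z where "a + 2 * of_int k * pi / of_int n = \<tau> + 2 * of_int z * pi"
    unfolding rcong_period_iff by blast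
  then have "of_int n * a = of_int n * \<tau> + 2 * of_int (n * z - k) * pi"
    using assms by (simp add: field_simps)
  then show "[of_int n * \<tau> = of_int n * a] (rmod 2 * pi)"
    unfolding rcong_period_iff by blast
next
  assume "[of_int n * \<tau> = of_int n * a] (rmod 2 * pi)"
  then obtain z where z: "of_int n * a = of_int n * \<tau> + 2 * of_int z * pi"
    unfolding rcong_period_iff by blast
  define k where "k = (- z) mod n"
  define q where "q = (- z) div n"
  have "- z = n * q + k"
    by (simp add: k_def q_def)
  then have z_eq: "z = - (n * q) - k"
    by linarith
  have "a + 2 * of_int k * pi / of_int n = \<tau> + 2 * of_int (- q) * pi"
    using z assms by (simp add: z_eq field_simps)
  then have "[\<tau> = a + 2 * of_int k * pi / of_int n] (rmod 2 * pi)"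
    unfolding rcong_period_iff by blast
  moreover have "k \<in> {0..n-1}"
    using assms by (simp add: k_def)
  ultimately show "\<exists>k\<in>{0..n-1}. [\<tau> = a + 2 * of_int k * pi / of_int n] (rmod 2 * pi)"
    by blast
qed

lemma cis_fraction_eq_iff:
  fixes n :: int
  assumes "n > 0"
  shows "cis (2 * of_int a * pi / of_int n) = cis (2 * of_int b * pi / of_int n) \<longleftrightarrow> n dvd b - a"
proof -
  have "2 * of_int b * pi / of_int n = 2 * of_int a * pi / of_int n + 2 * of_int z * pi
          \<longleftrightarrow> b - a = n * z" for z
  proof -
    have "2 * of_int b * pi / of_int n = 2 * of_int a * pi / of_int n + 2 * of_int z * pi
            \<longleftrightarrow> 2 * pi * of_int b = 2 * pi * of_int (a + n * z)"
      using assms by (simp add: field_simps)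
    also have "\<dots> \<longleftrightarrow> b = a + n * z"
      by (simp del: of_int_add of_int_mult)
    finally show ?thesis
      by linarith
  qed
  then show ?thesis
    unfolding cis_eq_iff rcong_period_iff by (auto simp: dvd_def)
qed

lemma dvd_diff_residues_iff:
  fixes n :: int
  assumes "j \<in> {0..n-1}" and "k \<in> {0..n-1}"
  shows "n dvd k - j \<longleftrightarrow> k = j"
  using assms mod_eq_dvd_iff[of k n j] by auto

section \<open>Sums of two harmonics\<close>

definition two_mode :: "real \<Rightarrow> real \<Rightarrow> int \<Rightarrow> int \<Rightarrow> real \<Rightarrow> complex" where
  "two_mode c1 c2 m l u = of_real c1 * cis (of_int m * u) + of_real c2 * cis (of_int l * u)"

lemma two_mode_has_vector_derivative:
  "\<exists>v. (two_mode c1 c2 m l has_vector_derivative v) (at u)"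
proof -
  define g where "g = (\<lambda>z. of_real c1 * exp (\<i> * of_int m * z) + of_real c2 * exp (\<i> * of_int l * z))"
  have "\<exists>v. (g has_field_derivative v) (at (of_real u))"
    unfolding g_def by (intro exI) (rule derivative_eq_intros refl)+
  then obtain v where "(g has_field_derivative v) (at (of_real u))"
    by blast
  then have "((\<lambda>x. g (of_real x)) has_vector_derivative v) (at u)"
    by (rule has_vector_derivative_real_field)
  moreover have "(\<lambda>x. g (of_real x)) = two_mode c1 c2 m l"
    by (simp add: g_def two_mode_def cis_conv_exp mult_ac fun_eq_iff)
  ultimately show ?thesis
    by auto
qed

lemma two_mode_period:
  assumes "[u = u'] (rmod 2 * pi)"
  shows "two_mode c1 c2 m l u = two_mode c1 c2 m l u'"
proof -
  obtain z where z: "u' = u + 2 * of_int z * pi"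
    using assms unfolding rcong_period_iff by blast
  have "cis (of_int q * u) = cis (of_int q * u')" for q
    unfolding cis_eq_iff rcong_period_iff z
    by (rule exI[of _ "q * z"]) (simp add: algebra_simps)
  then show ?thesis
    by (simp add: two_mode_def)
qed

text \<open>
  The two harmonics gain the phases \<open>2 \<pi> m k / n\<close> and \<open>2 \<pi> l k / n\<close> with \<open>n = l - m\<close>, which differ by
  the full number \<open>k\<close> of turns.
\<close>
lemma two_mode_shift:
  fixes k m l :: int
  assumes "l > m"
  shows "two_mode c1 c2 m l (u + 2 * of_int k * pi / of_int (l - m))
       = cis (2 * of_int (m * k) * pi / of_int (l - m)) * two_mode c1 c2 m l u"
proof -
  have "cis (2 * of_int (l * k) * pi / of_int (l - m)) = cis (2 * of_int (m * k) * pi / of_int (l - m))"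
    using assms by (subst cis_fraction_eq_iff) (auto simp flip: left_diff_distrib simp: dvd_diff_commute)
  moreover have "of_int q * (u + 2 * of_int k * pi / of_int (l - m))
      = 2 * of_int (q * k) * pi / of_int (l - m) + of_int q * u" for q
    by (simp add: algebra_simps)
  ultimately show ?thesis
    by (simp only: two_mode_def cis_mult [symmetric]) (simp add: algebra_simps)
qed

text \<open>
  Comparing the two rotations gives \<open>n dvd m * (k - j)\<close> with \<open>n = l - m\<close>, and \<open>m\<close> is coprime to \<open>n\<close>.
\<close>
lemma two_mode_shift_eq_iff:
  fixes j k m l :: int
  assumes "l > m" and "coprime m l" and "two_mode c1 c2 m l u \<noteq> 0"
  shows "two_mode c1 c2 m l (u + 2 * of_int j * pi / of_int (l - m))
       = two_mode c1 c2 m l (u + 2 * of_int k * pi / of_int (l - m)) \<longleftrightarrow> l - m dvd k - j"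
proof -
  have "coprime (l - m) m"
    using \<open>coprime m l\<close> by (metis coprime_commute coprime_iff_gcd_eq_1 gcd_diff1 gcd.commute)
  then have "l - m dvd m * k - m * j \<longleftrightarrow> l - m dvd k - j"
    by (metis coprime_dvd_mult_right_iff right_diff_distrib)
  then show ?thesis
    using assms by (simp only: two_mode_shift) (auto simp: cis_fraction_eq_iff simp del: of_int_mult of_int_diff)
qed

lemma norm_two_mode_squared:
  "(norm (two_mode c1 c2 m l u))\<^sup>2 = c1\<^sup>2 + c2\<^sup>2 + 2 * c1 * c2 * cos (of_int (l - m) * u)"
proof -
  have "(norm (two_mode c1 c2 m l u))\<^sup>2
      = c1\<^sup>2 * ((cos (of_int m * u))\<^sup>2 + (sin (of_int m * u))\<^sup>2)
      + c2\<^sup>2 * ((cos (of_int l * u))\<^sup>2 + (sin (of_int l * u))\<^sup>2)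
      + 2 * c1 * c2 * (cos (of_int l * u) * cos (of_int m * u) + sin (of_int l * u) * sin (of_int m * u))"
    by (simp only: cmod_power2) (simp add: two_mode_def power2_eq_square algebra_simps
        del: sin_cos_squared_add sin_cos_squared_add2 sin_cos_squared_add3)
  also have "cos (of_int l * u) * cos (of_int m * u) + sin (of_int l * u) * sin (of_int m * u)
      = cos (of_int (l - m) * u)"
    by (simp add: cos_diff left_diff_distrib)
  finally show ?thesis
    by simp
qed

lemma norm_two_mode_eq_iff:
  assumes "c1 \<noteq> 0" and "c2 \<noteq> 0"
  shows "norm (two_mode c1 c2 m l u) = norm (two_mode c1 c2 m l u') \<longleftrightarrow>
           [of_int (l - m) * u = of_int (l - m) * u'] (rmod 2 * pi) \<or>
           [of_int (l - m) * u = - (of_int (l - m) * u')] (rmod 2 * pi)"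
proof -
  have "norm (two_mode c1 c2 m l u) = norm (two_mode c1 c2 m l u') \<longleftrightarrow>
        (norm (two_mode c1 c2 m l u))\<^sup>2 = (norm (two_mode c1 c2 m l u'))\<^sup>2"
    by (simp add: power2_eq_iff_nonneg)
  also have "\<dots> \<longleftrightarrow> cos (of_int (l - m) * u) = cos (of_int (l - m) * u')"
    using assms by (simp only: norm_two_mode_squared) simp
  finally show ?thesis
    by (simp only: cos_eq_cos_conv_rmod_iff)
qed

text \<open>
  Equal values have equal moduli, which leaves the two signs for \<open>n s\<close> with \<open>n = l - m\<close>. With the sign
  \<open>+\<close>, the parameter \<open>s\<close> would be a shift of \<open>t\<close>; the shifts of \<open>t\<close> have distinct values,
  so \<open>s\<close> would be \<open>t\<close> itself.
\<close>
lemma two_mode_double_point: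
  assumes "l > m" and "coprime m l" and "c1 \<noteq> 0" and "c2 \<noteq> 0"
    and eq: "two_mode c1 c2 m l t = two_mode c1 c2 m l s" and nz: "two_mode c1 c2 m l t \<noteq> 0"
    and distinct: "\<not> [t = s] (rmod 2 * pi)"
  shows "\<not> [of_int (l - m) * s = of_int (l - m) * t] (rmod 2 * pi)"
    and "[of_int (l - m) * s = - (of_int (l - m) * t)] (rmod 2 * pi)"
proof -
  show not_cong: "\<not> [of_int (l - m) * s = of_int (l - m) * t] (rmod 2 * pi)"
  proof
    assume "[of_int (l - m) * s = of_int (l - m) * t] (rmod 2 * pi)"
    then obtain k where k: "k \<in> {0..l-m-1}"
        "[s = t + 2 * of_int k * pi / of_int (l - m)] (rmod 2 * pi)"
      using shift_orbit_iff[of "l - m" s t] \<open>l > m\<close> by auto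
    have "two_mode c1 c2 m l (t + 2 * of_int 0 * pi / of_int (l - m))
        = two_mode c1 c2 m l (t + 2 * of_int k * pi / of_int (l - m))"
      using eq two_mode_period[OF k(2)] by simp
    then have "l - m dvd k - 0"
      using two_mode_shift_eq_iff[OF assms(1,2) nz] by blast
    then have "k = 0"
      using k(1) dvd_diff_residues_iff[of 0 "l - m" k] by auto
    then show False
      using k(2) distinct by (simp add: rcong_sym_iff)
  qed
  then show "[of_int (l - m) * s = - (of_int (l - m) * t)] (rmod 2 * pi)"
    using norm_two_mode_eq_iff[OF assms(3,4), of m l s t] eq by auto
qed

section \<open>The orbit of a self-intersection\<close>

theorem theorem5p4:
  fixes m l :: int and c1 c2 t0 s0 :: real and w0 :: complex
    and f :: "real \<Rightarrow> complex" and t s :: "int \<Rightarrow> real"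
  assumes "coprime m l" and "l > m" and "c1 \<noteq> 0" and "c2 \<noteq> 0"
    and f_def: "\<And>u. f u = of_real c1 * exp (\<i> * of_real u * of_int m)
                        + of_real c2 * exp (\<i> * of_real u * of_int l)"
    and "self_intersection_point f w0 t0 s0" and "w0 \<noteq> 0"
    and t_def: "\<And>k. t k = t0 + 2 * of_int k * pi / of_int (l - m)"
    and s_def: "\<And>j. s j = s0 + 2 * of_int j * pi / of_int (l - m)"
  shows
    "(\<forall>k\<in>{0..l-m-1}. \<forall>j\<in>{0..l-m-1}.
        (k \<noteq> j \<longrightarrow> \<not> [t k = t j] (rmod 2 * pi) \<and> \<not> [s k = s j] (rmod 2 * pi)) \<and>
        \<not> [t k = s j] (rmod 2 * pi))
     \<and> (\<forall>k\<in>{0..l-m-1}. f (t k) = f (s k))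
     \<and> (inj_on (\<lambda>k. f (t k)) {0..l-m-1} \<and>
        (\<forall>k\<in>{0..l-m-1}. self_intersection_point f (f (t k)) (t k) (s k)))
     \<and> (\<forall>\<tau>. norm (f \<tau>) = norm (f t0) \<longrightarrow>
          (\<exists>k\<in>{0..l-m-1}. \<exists>j\<in>{0..l-m-1}. [\<tau> = t k] (rmod 2 * pi) \<or> [\<tau> = s j] (rmod 2 * pi)))
     \<and> (\<forall>\<tau>.
          (\<exists>k\<in>{0..l-m-1}. \<exists>j\<in>{0..l-m-1}. [\<tau> = t k] (rmod 2 * pi) \<or> [\<tau> = s j] (rmod 2 * pi)) \<longrightarrow>
          (\<exists>k\<in>{0..l-m-1}. \<exists>j\<in>{0..l-m-1}. [-\<tau> = t k] (rmod 2 * pi) \<or> [-\<tau> = s j] (rmod 2 * pi)))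
     \<and> (\<forall>k\<in>{0..l-m-1}. \<forall>\<tau>.
          (\<not> [\<tau> = t k] (rmod 2 * pi) \<and> f \<tau> = f (t k)) \<longleftrightarrow> [\<tau> = s k] (rmod 2 * pi))"
proof -
  define n where "n = l - m"
  have n_pos: "n > 0"
    using \<open>l > m\<close> by (simp add: n_def)
  have f_eq: "f = two_mode c1 c2 m l"
    by (rule ext) (simp add: f_def two_mode_def cis_conv_exp mult_ac)
  have self: "self_intersection_point f w0 t0 s0"
    by fact
  then have f_t0: "f t0 = w0" and f_s0: "f s0 = w0" and distinct: "\<not> [t0 = s0] (rmod 2 * pi)"
    by (auto simp: self_intersection_point_def)
  define \<omega> where "\<omega> = (\<lambda>k. cis (2 * of_int (m * k) * pi / of_int n))"
  have f_t: "f (t k) = \<omega> k * w0" and f_s: "f (s k) = \<omega> k * w0" for k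
    using two_mode_shift[OF \<open>l > m\<close>] f_t0 f_s0 by (simp_all only: t_def s_def f_eq \<omega>_def n_def)
  have same_value_iff: "f (t j) = f (t k) \<longleftrightarrow> j = k" if "j \<in> {0..n-1}" "k \<in> {0..n-1}" for j k
    using two_mode_shift_eq_iff[OF \<open>l > m\<close> \<open>coprime m l\<close>, of c1 c2 t0 j k] \<open>w0 \<noteq> 0\<close> f_t0
      dvd_diff_residues_iff[OF that] by (auto simp: f_eq t_def n_def)
  have f_period: "f u = f u'" if "[u = u'] (rmod 2 * pi)" for u u'
    unfolding f_eq using that by (rule two_mode_period)

  have orbit_t: "(\<exists>k\<in>{0..n-1}. [\<tau> = t k] (rmod 2 * pi)) \<longleftrightarrow> [of_int n * \<tau> = of_int n * t0] (rmod 2 * pi)"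
    and orbit_s: "(\<exists>k\<in>{0..n-1}. [\<tau> = s k] (rmod 2 * pi)) \<longleftrightarrow> [of_int n * \<tau> = of_int n * s0] (rmod 2 * pi)"
    for \<tau>
    using shift_orbit_iff[OF n_pos] by (simp_all add: t_def s_def n_def)
  have not_cong: "\<not> [of_int n * s0 = of_int n * t0] (rmod 2 * pi)"
    and cong_minus: "[of_int n * s0 = - (of_int n * t0)] (rmod 2 * pi)"
    using two_mode_double_point[OF \<open>l > m\<close> \<open>coprime m l\<close> \<open>c1 \<noteq> 0\<close> \<open>c2 \<noteq> 0\<close>, of t0 s0]
      f_t0 f_s0 \<open>w0 \<noteq> 0\<close> distinct by (simp_all add: f_eq n_def)
  have t_not_s: "\<not> [t k = s j] (rmod 2 * pi)" if "k \<in> {0..n-1}" "j \<in> {0..n-1}" for k j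
  proof
    assume "[t k = s j] (rmod 2 * pi)"
    then have "[of_int n * t k = of_int n * s0] (rmod 2 * pi)"
      using orbit_s that by blast
    moreover have "[of_int n * t k = of_int n * t0] (rmod 2 * pi)"
      using orbit_t that rcong_refl by blast
    ultimately show False
      using not_cong by (metis rcong_sym rcong_trans)
  qed
  define on_orbits where "on_orbits = (\<lambda>\<tau>. \<exists>k\<in>{0..n-1}. \<exists>j\<in>{0..n-1}.
      [\<tau> = t k] (rmod 2 * pi) \<or> [\<tau> = s j] (rmod 2 * pi))"
  have on_orbits_iff_either: "on_orbits \<tau> \<longleftrightarrow>
      (\<exists>k\<in>{0..n-1}. [\<tau> = t k] (rmod 2 * pi)) \<or> (\<exists>j\<in>{0..n-1}. [\<tau> = s j] (rmod 2 * pi))" for \<tau>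
    unfolding on_orbits_def using n_pos by fastforce
  \<comment> \<open>The modulus determines \<open>cos (n \<tau>)\<close>, an even function, whence the symmetry under \<open>\<tau> \<mapsto> - \<tau>\<close>.\<close>
  have on_orbits_iff: "on_orbits \<tau> \<longleftrightarrow> norm (f \<tau>) = norm (f t0)" for \<tau>
  proof -
    have "[of_int n * \<tau> = of_int n * s0] (rmod 2 * pi) \<longleftrightarrow> [of_int n * \<tau> = - (of_int n * t0)] (rmod 2 * pi)"
      using cong_minus by (metis rcong_sym rcong_trans)
    then show ?thesis
      unfolding on_orbits_iff_either orbit_t orbit_s
      using norm_two_mode_eq_iff[OF \<open>c1 \<noteq> 0\<close> \<open>c2 \<noteq> 0\<close>, of m l \<tau> t0] by (simp add: f_eq n_def)
  qed
  have norm_f_minus: "norm (f (- \<tau>)) = norm (f \<tau>)" for \<tau>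
    using norm_two_mode_eq_iff[OF \<open>c1 \<noteq> 0\<close> \<open>c2 \<noteq> 0\<close>, of m l "- \<tau>" \<tau>] by (simp add: f_eq)

  have "\<forall>k\<in>{0..n-1}. \<forall>j\<in>{0..n-1}.
      (k \<noteq> j \<longrightarrow> \<not> [t k = t j] (rmod 2 * pi) \<and> \<not> [s k = s j] (rmod 2 * pi)) \<and>
      \<not> [t k = s j] (rmod 2 * pi)"
    using same_value_iff f_period t_not_s f_t f_s by metis
  moreover have "\<forall>k\<in>{0..n-1}. f (t k) = f (s k)"
    by (simp add: f_t f_s)
  moreover have "inj_on (\<lambda>k. f (t k)) {0..n-1}"
    using same_value_iff by (auto simp: inj_on_def)
  moreover have "\<forall>k\<in>{0..n-1}. self_intersection_point f (f (t k)) (t k) (s k)"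
  proof
    fix k
    obtain v w where "(f has_vector_derivative v) (at t0)" and "(f has_vector_derivative w) (at s0)"
      unfolding f_eq using two_mode_has_vector_derivative by blast
    moreover have "f (u + 2 * of_int k * pi / of_int n) = \<omega> k * f u" for u
      unfolding f_eq \<omega>_def n_def using \<open>l > m\<close> by (rule two_mode_shift)
    moreover have "\<omega> k \<noteq> 0"
      by (simp add: \<omega>_def)
    ultimately have "self_intersection_point f (\<omega> k * w0)
        (t0 + 2 * of_int k * pi / of_int n) (s0 + 2 * of_int k * pi / of_int n)"
      using self self_intersection_point_rotate by blast
    then show "self_intersection_point f (f (t k)) (t k) (s k)"
      by (simp add: f_t) (simp add: t_def s_def n_def)
  qed
  moreover have "on_orbits (- \<tau>)" if "on_orbits \<tau>" for \<tau>
    using that by (simp add: on_orbits_iff norm_f_minus)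
  moreover have "\<not> [\<tau> = t k] (rmod 2 * pi) \<and> f \<tau> = f (t k) \<longleftrightarrow> [\<tau> = s k] (rmod 2 * pi)"
    if k: "k \<in> {0..n-1}" for k \<tau>
  proof
    assume *: "\<not> [\<tau> = t k] (rmod 2 * pi) \<and> f \<tau> = f (t k)"
    then have "norm (f \<tau>) = norm (f t0)"
      by (simp add: f_t f_t0 \<omega>_def norm_mult)
    then consider j where "j \<in> {0..n-1}" "[\<tau> = t j] (rmod 2 * pi)"
      | j where "j \<in> {0..n-1}" "[\<tau> = s j] (rmod 2 * pi)"
      using on_orbits_iff on_orbits_iff_either by blast
    then show "[\<tau> = s k] (rmod 2 * pi)"
    proof cases
      case 1
      then have "j = k"
        using same_value_iff[OF _ k] f_period * by metis
      with 1 * show ?thesis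
        by blast
    next
      case 2
      then have "f (t j) = f (t k)"
        using f_period * by (metis f_t f_s)
      with 2 show ?thesis
        using same_value_iff[OF _ k] by blast
    qed
  next
    assume *: "[\<tau> = s k] (rmod 2 * pi)"
    then have "f \<tau> = f (t k)"
      using f_period by (metis f_t f_s)
    moreover have "\<not> [\<tau> = t k] (rmod 2 * pi)"
      using t_not_s[OF k k] * by (metis rcong_sym rcong_trans)
    ultimately show "\<not> [\<tau> = t k] (rmod 2 * pi) \<and> f \<tau> = f (t k)"
      by blast
  qed
  moreover have "on_orbits \<tau>" if "norm (f \<tau>) = norm (f t0)" for \<tau>
    using that by (simp add: on_orbits_iff)
  ultimately show ?thesis
    unfolding n_def on_orbits_def by (intro conjI allI ballI impI) simp_all
qed

end
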